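(* Let $n \geq 2$ and $G = F_{n,\infty}$. Let $\mathcal{A}$ be the set of all subgroups of finite index in $G$. Then $\sup_{H \in \mathcal{A}} d(H) < \infty$.
   Context: For $n \geq 2$, the generalised Thompson group is $F_{n,\infty} = \langle x_0, x_1, \ldots, x_m, \ldots \mid x_i^{x_j} = x_{i+n-1} \text{ for } i > j \geq 0 \rangle$, where $x^y = y^{-1}xy$. For a finitely generated group $H$, $d(H)$ denotes the minimal number of generators of $H$. *)

theory Defs
  imports "HOL-Algebra.Algebra"
begin

text \<open>Words in the generators x_0, x_1, ...: a letter (i, False) is x_i,
  a letter (i, True) is the inverse of x_i.\<close>
type_synonym letter = "nat \<times> bool"

inductive F_eq :: "nat \<Rightarrow> letter list \<Rightarrow> letter list \<Rightarrow> bool" for n :: nat where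
  F_refl: "F_eq n w w"
| F_sym: "F_eq n u v \<Longrightarrow> F_eq n v u"
| F_trans: "F_eq n u v \<Longrightarrow> F_eq n v w \<Longrightarrow> F_eq n u w"
| F_free: "F_eq n [(i, b), (i, \<not> b)] []"
| F_rel: "j < i \<Longrightarrow> F_eq n [(j, True), (i, False), (j, False)] [(i + n - 1, False)]"
| F_cong: "F_eq n u u' \<Longrightarrow> F_eq n v v' \<Longrightarrow> F_eq n (u @ v) (u' @ v')"

definition thompson_F :: "nat \<Rightarrow> letter list set monoid" where
  "thompson_F n = \<lparr> carrier = {A. \<exists>w. A = {v. F_eq n w v}},
     Group.monoid.mult = (\<lambda>A B. {v. \<exists>a\<in>A. \<exists>b\<in>B. F_eq n (a @ b) v}),
     Group.monoid.one = {v. F_eq n [] v} \<rparr>"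

definition min_gens :: "('a, 'b) monoid_scheme \<Rightarrow> 'a set \<Rightarrow> nat" where
  "min_gens G H = (LEAST k. \<exists>S. finite S \<and> card S = k \<and> S \<subseteq> H \<and> generate G S = H)"

end

theory Submission
  imports Defs
begin

text \<open>
  Put m = n - 1 and c_i = x_i x_{i+m}^{-1}. If H has finite index, every element of G has its k-th
  power in the normal core of H for a common k > 0. Modulo the core, conjugation by x_0^k shows
  that x_i = x_{i+km} for i > 0, and then x_{i+m} = x_{i+km+m} = x_i^{x_i} = x_i; so the core
  contains every c_i with i > 0, and all conjugates of these.

  The point is that the normal closure V of the c_i is exhausted by conjugates of one finitely
  generated subgroup D, independent of H. Take D generated by c_1 and the conjugates
  x_1^a c_i x_1^{-a} with 2 \<le> i \<le> m + 1 and a \<le> 2. Then x_1 D x_1^{-1} is contained in D, because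
  x_1 c_1 x_1^{-1} = c_1 (x_1 c_{m+1} x_1^{-1})^{-1} and, for a \<ge> 2, conjugating x_1^a c_i x_1^{-a}
  by c_1 has the same effect as conjugating it by x_1. So the conjugates of D under powers of x_1
  form an ascending union U. It contains all c_i with i > 0, and each of its elements commutes with
  x_j for all large j; hence it is normalised by all x_i with i > 0. Moreover U is mapped into
  itself by x_0, and the ascending union V of its conjugates under powers of x_0 is normal in G.
  Both unions are still exhausted if one uses only k-th powers, so V is contained in the subgroup
  generated by D, x_0^k and x_1^k. Finally G/V is abelian and generated by m + 1 elements, so
  H/V needs at most m + 1 generators.
\<close>

section \<open>Conjugation and directed unions of conjugates\<close>

definition cj :: "('a, 'b) monoid_scheme \<Rightarrow> 'a \<Rightarrow> 'a \<Rightarrow> 'a" where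
  "cj G a g = a \<otimes>\<^bsub>G\<^esub> g \<otimes>\<^bsub>G\<^esub> inv\<^bsub>G\<^esub> a"

context group
begin

lemma l_inv_mult_cancel: "a \<in> carrier G \<Longrightarrow> b \<in> carrier G \<Longrightarrow> inv a \<otimes> (a \<otimes> b) = b"
  by (metis inv_closed l_inv l_one m_assoc)

lemma r_inv_mult_cancel: "a \<in> carrier G \<Longrightarrow> b \<in> carrier G \<Longrightarrow> a \<otimes> (inv a \<otimes> b) = b"
  by (metis inv_closed r_inv l_one m_assoc)

lemmas word_simps = m_assoc inv_mult_group l_inv_mult_cancel r_inv_mult_cancel

lemma cj_closed [simp, intro]: "a \<in> carrier G \<Longrightarrow> g \<in> carrier G \<Longrightarrow> cj G a g \<in> carrier G"
  by (simp add: cj_def)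

lemma cj_mult: "a \<in> carrier G \<Longrightarrow> g \<in> carrier G \<Longrightarrow> h \<in> carrier G \<Longrightarrow>
    cj G a (g \<otimes> h) = cj G a g \<otimes> cj G a h"
  by (simp add: cj_def word_simps)

lemma cj_inv: "a \<in> carrier G \<Longrightarrow> g \<in> carrier G \<Longrightarrow> cj G a (inv g) = inv (cj G a g)"
  by (simp add: cj_def word_simps)

lemma cj_cj: "a \<in> carrier G \<Longrightarrow> b \<in> carrier G \<Longrightarrow> g \<in> carrier G \<Longrightarrow>
    cj G a (cj G b g) = cj G (a \<otimes> b) g"
  by (simp add: cj_def word_simps)

lemma cj_by_one [simp]: "g \<in> carrier G \<Longrightarrow> cj G \<one> g = g"
  by (simp add: cj_def)

lemma cj_one [simp]: "a \<in> carrier G \<Longrightarrow> cj G a \<one> = \<one>"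
  by (simp add: cj_def)

lemma cj_inv_cancel [simp]:
  assumes "a \<in> carrier G" "g \<in> carrier G"
  shows "cj G (inv a) (cj G a g) = g" "cj G a (cj G (inv a) g) = g"
  using assms by (simp_all add: cj_cj)

lemma cj_pow_Suc:
  assumes "a \<in> carrier G" "g \<in> carrier G"
  shows "cj G (a [^] Suc r) g = cj G a (cj G (a [^] r) g)"
    and "cj G (a [^] Suc r) g = cj G (a [^] r) (cj G a g)"
  using assms by (simp_all add: cj_cj flip: nat_pow_Suc2)

text \<open>Conjugation by \<open>a\<close> is an automorphism, so it carries the action of
  \<open>g\<close> to the action of its image. This tracks how conjugators such as powers of x_1 are
  moved by x_0.\<close>

lemma cj_cj_distrib:
  assumes "a \<in> carrier G" "g \<in> carrier G" "y \<in> carrier G"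
  shows "cj G a (cj G g y) = cj G (cj G a g) (cj G a y)"
  using assms by (simp add: cj_def word_simps)

lemma cj_pow:
  assumes "a \<in> carrier G" "y \<in> carrier G"
  shows "cj G a (y [^] (r::nat)) = cj G a y [^] r"
  using assms by (induction r) (simp_all add: cj_mult)

lemma cj_eq_self_iff:
  assumes "a \<in> carrier G" "g \<in> carrier G"
  shows "cj G a g = g \<longleftrightarrow> cj G g a = a"
  unfolding cj_def using assms by (metis inv_solve_right m_closed)

lemma subgroup_cj_closed:
  assumes "subgroup H G" "a \<in> H" "g \<in> H"
  shows "cj G a g \<in> H"
  using assms unfolding cj_def by (simp add: subgroup.m_closed subgroup.m_inv_closed)

lemma cj_generate_subset:
  assumes "Y \<subseteq> carrier G" "a \<in> carrier G" "subgroup K G" "\<And>s. s \<in> Y \<Longrightarrow> cj G a s \<in> K"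
    and "g \<in> generate G Y"
  shows "cj G a g \<in> K"
  using assms(5)
proof (induction rule: generate.induct)
  case one
  then show ?case using assms by (simp add: subgroup.one_closed)
next
  case (incl h)
  then show ?case using assms by simp
next
  case (inv h)
  then show ?case using assms by (metis cj_inv subgroup.m_inv_closed subsetD)
next
  case (eng h1 h2)
  then show ?case
    using assms generate_in_carrier[OF assms(1)] by (simp add: cj_mult subgroup.m_closed)
qed

text \<open>Conjugation by \<open>a\<close> alone could map \<open>V\<close> properly into itself,
  hence the condition on \<open>a\<close> and its inverse. Induction on the generated elements
  extends it to products.\<close>

lemma normal_if_generators_normalise:
  assumes V: "subgroup V G" and Y: "Y \<subseteq> carrier G" "generate G Y = carrier G"
    and inv: "\<And>a v. a \<in> Y \<Longrightarrow> v \<in> V \<Longrightarrow> cj G a v \<in> V \<and> cj G (inv a) v \<in> V"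
  shows "V \<lhd> G"
proof (rule normal_invI[OF V])
  fix g v assume "g \<in> carrier G" "v \<in> V"
  then have "g \<in> generate G Y" by (simp add: Y)
  then have "\<forall>v\<in>V. cj G g v \<in> V"
  proof (induction rule: generate.induct)
    case one
    then show ?case using subgroup.mem_carrier[OF V] by auto
  next
    case (incl h)
    then show ?case using inv by simp
  next
    case (inv h)
    then show ?case using assms(4) by simp
  next
    case (eng h1 h2)
    then have "h1 \<in> carrier G" "h2 \<in> carrier G" using Y by auto
    then show ?case using eng.IH subgroup.mem_carrier[OF V] by (simp flip: cj_cj)
  qed
  then show "g \<otimes> v \<otimes> inv g \<in> V" using \<open>v \<in> V\<close> by (simp add: cj_def)
qed

text \<open>Centralisers are subgroups. That of a generator contains \<open>Y\<close>, hence all of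
  \<open>G\<close>; so the centraliser of an arbitrary element contains \<open>Y\<close> as
  well.\<close>

lemma comm_group_if_generators_commute:
  assumes Y: "Y \<subseteq> carrier G" "generate G Y = carrier G"
    and comm: "\<And>a b. a \<in> Y \<Longrightarrow> b \<in> Y \<Longrightarrow> a \<otimes> b = b \<otimes> a"
  shows "comm_group G"
proof (rule group_comm_groupI)
  have cent: "subgroup {g \<in> carrier G. cj G b g = g} G" if "b \<in> carrier G" for b
    using that by (intro subgroupI) (auto simp: cj_mult cj_inv intro!: exI[of _ \<one>])
  have eq: "cj G b g = g \<longleftrightarrow> g \<otimes> b = b \<otimes> g" if "b \<in> carrier G" "g \<in> carrier G" for b g
    unfolding cj_def using that by (metis inv_solve_right' m_closed)
  have 1: "cj G b g = g" if "b \<in> Y" "g \<in> carrier G" for b g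
  proof -
    have "generate G Y \<subseteq> {g \<in> carrier G. cj G b g = g}"
      using that Y comm eq by (intro generate_subgroup_incl cent) (auto simp: subset_iff)
    then show ?thesis using that Y by auto
  qed
  fix g h assume gh: "g \<in> carrier G" "h \<in> carrier G"
  have "generate G Y \<subseteq> {b \<in> carrier G. cj G g b = b}"
    using gh Y 1 cj_eq_self_iff by (intro generate_subgroup_incl cent) (auto simp: subset_iff)
  then show "g \<otimes> h = h \<otimes> g" using gh Y eq[of g h] by auto
qed

text \<open>The union of the conjugates of D by negative powers of t, ascending when t D t^{-1} is
  contained in D.\<close>

definition sat :: "'a \<Rightarrow> 'a set \<Rightarrow> 'a set" where
  "sat t D = {g \<in> carrier G. \<exists>r::nat. cj G (t [^] r) g \<in> D}"

context
  fixes t D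
  assumes t: "t \<in> carrier G" and D: "subgroup D G"
    and shrink: "\<And>d. d \<in> D \<Longrightarrow> cj G t d \<in> D"
begin

lemma cj_pow_mono:
  assumes "g \<in> carrier G" "cj G (t [^] (r::nat)) g \<in> D" "r \<le> s"
  shows "cj G (t [^] s) g \<in> D"
  using assms(3,2)
  by (induction s rule: dec_induct)
    (simp_all add: cj_pow_Suc(1) t assms(1) shrink del: nat_pow_Suc Group.nat_pow_Suc)

lemma subgroup_sat: "subgroup (sat t D) G"
proof (rule subgroupI)
  show "sat t D \<subseteq> carrier G" by (auto simp: sat_def)
  have "\<one> \<in> sat t D" using D t by (simp add: sat_def subgroup.one_closed)
  then show "sat t D \<noteq> {}" by blast
next
  fix g assume "g \<in> sat t D"
  then obtain r where "g \<in> carrier G" "cj G (t [^] (r::nat)) g \<in> D" by (auto simp: sat_def)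
  then have "inv g \<in> carrier G" "cj G (t [^] r) (inv g) \<in> D"
    using D t by (simp_all add: cj_inv subgroup.m_inv_closed)
  then show "inv g \<in> sat t D" unfolding sat_def by blast
next
  fix g h assume "g \<in> sat t D" "h \<in> sat t D"
  then obtain r s where *: "g \<in> carrier G" "h \<in> carrier G"
    "cj G (t [^] (r::nat)) g \<in> D" "cj G (t [^] (s::nat)) h \<in> D"
    by (auto simp: sat_def)
  have "cj G (t [^] (r + s)) g \<in> D" "cj G (t [^] (r + s)) h \<in> D"
    using * by (auto intro: cj_pow_mono)
  then show "g \<otimes> h \<in> sat t D"
    unfolding sat_def using * t D by (auto intro!: exI[of _ "r + s"] simp: cj_mult subgroup.m_closed)
qed

lemma subset_sat: "D \<subseteq> sat t D"
  using subgroup.mem_carrier[OF D] by (auto simp: sat_def intro!: exI[of _ 0])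

lemma cj_sat:
  assumes "g \<in> sat t D"
  shows "cj G t g \<in> sat t D" "cj G (inv t) g \<in> sat t D"
proof -
  from assms obtain r where *: "g \<in> carrier G" "cj G (t [^] (r::nat)) g \<in> D" by (auto simp: sat_def)
  have "cj G (t [^] r) (cj G t g) \<in> D"
    using * cj_pow_mono[OF *, of "Suc r"] t by (simp add: cj_pow_Suc(2) del: nat_pow_Suc Group.nat_pow_Suc)
  then show "cj G t g \<in> sat t D" using * t by (auto simp: sat_def)
  have "cj G (t [^] Suc r) (cj G (inv t) g) \<in> D"
    using * t by (simp add: cj_pow_Suc(2) del: nat_pow_Suc Group.nat_pow_Suc)
  then show "cj G (inv t) g \<in> sat t D"
    unfolding sat_def using * t by blast
qed

text \<open>Conjugates that have entered \<open>D\<close> stay there, so the exponent r can be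
  enlarged to the multiple \<open>k * r\<close>, and conjugation by that power of \<open>t\<close>
  can be undone inside \<open>K\<close>.\<close>

lemma sat_subset:
  assumes K: "subgroup K G" "D \<subseteq> K" and k: "t [^] (k::nat) \<in> K" "k > 0"
  shows "sat t D \<subseteq> K"
proof
  fix g assume "g \<in> sat t D"
  then obtain r where *: "g \<in> carrier G" "cj G (t [^] (r::nat)) g \<in> D" by (auto simp: sat_def)
  let ?u = "(t [^] k) [^] r"
  have u: "?u \<in> K" using K k by (metis subgroup_int_pow_closed int_pow_int)
  have "cj G (t [^] (k * r)) g \<in> D" using cj_pow_mono[OF *, of "k * r"] k by simp
  then have "cj G ?u g \<in> K" using K t by (auto simp: nat_pow_pow)
  then have "cj G (inv ?u) (cj G ?u g) \<in> K"
    using u K by (simp only: subgroup_cj_closed subgroup.m_inv_closed)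
  then show "g \<in> K" using t * by (simp only: cj_inv_cancel nat_pow_closed)
qed

end

section \<open>Generators modulo a subgroup with abelian quotient\<close>

definition core :: "'a set \<Rightarrow> 'a set" where
  "core H = {g \<in> carrier G. \<forall>a\<in>carrier G. cj G a g \<in> H}"

lemma core_subset: "core H \<subseteq> H"
  unfolding core_def by (metis (no_types, lifting) cj_by_one mem_Collect_eq one_closed subsetI)

lemma core_normal:
  assumes "subgroup H G"
  shows "core H \<lhd> G"
proof (rule normal_invI)
  show "subgroup (core H) G"
  proof (rule subgroupI)
    have "\<one> \<in> core H" using assms by (simp add: core_def subgroup.one_closed)
    then show "core H \<noteq> {}" by blast
  qed (use assms in \<open>auto simp: core_def cj_inv cj_mult subgroup.m_closed subgroup.m_inv_closed\<close>)
  fix g h assume "g \<in> carrier G" "h \<in> core H"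
  then have "cj G g h \<in> core H" by (auto simp: core_def cj_cj)
  then show "g \<otimes> h \<otimes> inv g \<in> core H" by (simp add: cj_def)
qed

text \<open>Pigeonhole on the cosets H a g^r, with r from 0 to the index, gives some d > 0, at most
  the index, with a g^d a^{-1} in \<open>H\<close>. The factorial is a multiple of every such d, so
  one exponent serves all \<open>a\<close> and \<open>g\<close>.\<close>

lemma pow_fact_index_in_core:
  assumes H: "subgroup H G" and fin: "finite (rcosets H)" and g: "g \<in> carrier G"
  shows "g [^] (fact (card (rcosets H)) :: nat) \<in> core H"
proof -
  let ?n = "card (rcosets H)"
  have "cj G a (g [^] (fact ?n :: nat)) \<in> H" if a: "a \<in> carrier G" for a
  proof -
    have "(\<lambda>r::nat. H #> (a \<otimes> g [^] r)) ` {0..?n} \<subseteq> rcosets H"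
      using a g subgroup.subset[OF H] by (auto intro!: rcosetsI)
    then have "\<not> inj_on (\<lambda>r::nat. H #> (a \<otimes> g [^] r)) {0..?n}"
      using card_inj_on_le[OF _ _ fin] by force
    then obtain r s :: nat where rs: "r < s" "s \<le> ?n" "H #> (a \<otimes> g [^] r) = H #> (a \<otimes> g [^] s)"
      unfolding inj_on_def by (metis atLeastAtMost_iff linorder_neqE_nat)
    define d where "d = s - r"
    have s: "s = d + r" and d: "0 < d" "d \<le> ?n" using rs by (auto simp: d_def)
    have "a \<otimes> g [^] s \<in> H #> (a \<otimes> g [^] r)"
      using rs a g H by (intro repr_independenceD) auto
    then obtain h where h: "h \<in> H" "a \<otimes> g [^] s = h \<otimes> (a \<otimes> g [^] r)"
      by (auto simp: r_coset_def)
    have hc: "h \<in> carrier G" using h H by (simp add: subgroup.mem_carrier)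
    have "(a \<otimes> g [^] d) \<otimes> g [^] r = (h \<otimes> a) \<otimes> g [^] r"
      using h hc a g unfolding s by (simp add: m_assoc nat_pow_mult)
    then have "a \<otimes> g [^] d = h \<otimes> a" using a g hc by simp
    then have "cj G a (g [^] d) = h" unfolding cj_def using a g hc by (simp add: m_assoc)
    moreover have "cj G a (g [^] (d * q)) = cj G a (g [^] d) [^] q" for q
      using a g by (induction q) (simp_all add: cj_mult add.commute[of d] flip: nat_pow_mult)
    moreover have "d dvd fact ?n" using d by (intro dvd_fact) auto
    ultimately show ?thesis
      using h(1) H by (metis dvdE subgroup_int_pow_closed int_pow_int)
  qed
  then show ?thesis using g by (simp add: core_def)
qed

text \<open>A conjugate g p g^{-1} is the commutator of g and p times p.\<close>

lemma normal_if_derived_subset: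
  assumes P: "subgroup P G" and der: "derived G (carrier G) \<subseteq> P"
  shows "P \<lhd> G"
proof (rule normal_invI[OF P])
  fix g p assume g: "g \<in> carrier G" and p: "p \<in> P"
  have pc: "p \<in> carrier G" using p P by (simp add: subgroup.mem_carrier)
  have "g \<otimes> p \<otimes> inv g \<otimes> inv p \<in> derived G (carrier G)"
    unfolding derived_def using g pc by (intro generate.incl) auto
  then have "(g \<otimes> p \<otimes> inv g \<otimes> inv p) \<otimes> p \<in> P"
    using der p P by (auto intro: subgroup.m_closed)
  then show "g \<otimes> p \<otimes> inv g \<in> P" using g pc by (simp add: m_assoc)
qed

lemma group_hom_r_coset:
  assumes "P \<lhd> G"
  shows "group_hom G (G Mod P) (\<lambda>g. P #> g)"
  using assms by (simp add: group_hom_def group_hom_axioms_def is_group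
      normal.factorgroup_is_group normal.r_coset_hom_Mod)

lemma kernel_r_coset:
  assumes "P \<lhd> G"
  shows "kernel G (G Mod P) (\<lambda>g. P #> g) = P"
proof -
  interpret P: normal P G by fact
  show ?thesis
    unfolding kernel_def FactGroup_def
    using coset_join1[of P] coset_join2[OF _ P.subgroup_axioms] P.subgroup_axioms P.subset by auto
qed

end

text \<open>As for subgroups of the integers: take an element of \<open>K\<close> mapping to the
  least positive power of \<open>a\<close> that occurs. Dividing exponents by this least one leaves
  remainder 0, so every element of \<open>K\<close> is a power of the chosen one up to the
  kernel.\<close>

lemma (in group_hom) subgroup_with_cyclic_image:
  assumes K: "subgroup K G" and a: "a \<in> carrier H"
    and cyc: "\<And>g. g \<in> K \<Longrightarrow> \<exists>z::int. h g = a [^]\<^bsub>H\<^esub> z"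
  shows "\<exists>g\<in>K. generate G (insert g (K \<inter> kernel G H h)) = K"
proof -
  have Kc: "K \<subseteq> carrier G" using K by (rule subgroup.subset)
  define I where "I = {d::nat. d > 0 \<and> (\<exists>g\<in>K. h g = a [^]\<^bsub>H\<^esub> int d)}"
  have sub: "generate G (insert g (K \<inter> kernel G H h)) \<subseteq> K" if "g \<in> K" for g
    using that K by (intro G.generate_subgroup_incl) auto
  show ?thesis
  proof (cases "I = {}")
    \<comment> \<open>No positive exponent occurs, hence by inversion no negative one:
      \<open>K\<close> lies in the kernel and the identity serves as the extra generator.\<close>
    case True
    have "g \<in> kernel G H h" if g: "g \<in> K" for g
    proof -
      obtain z :: int where z: "h g = a [^]\<^bsub>H\<^esub> z" using cyc g by blast
      have "h (inv g) = a [^]\<^bsub>H\<^esub> (- z)" using g Kc a z by (auto simp: H.int_pow_neg)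
      moreover have "inv g \<in> K" using K g by (simp add: subgroup.m_inv_closed)
      ultimately have "nat (- z) \<in> I" if "- z > 0" using that by (auto simp: I_def)
      moreover have "nat z \<in> I" if "z > 0" using that g z by (auto simp: I_def)
      ultimately have "z = 0" using True by force
      then show ?thesis using z g Kc by (auto simp: kernel_def)
    qed
    then have "K \<subseteq> generate G (insert \<one> (K \<inter> kernel G H h))"
      by (auto intro: generate.incl)
    then show ?thesis using sub K by (metis subgroup.one_closed subset_antisym)
  next
    case False
    define d where "d = (LEAST d. d \<in> I)"
    have dI: "d \<in> I" unfolding d_def using False by (meson LeastI_ex ex_in_conv)
    have dmin: "d \<le> e" if "e \<in> I" for e unfolding d_def using that by (rule Least_le)
    from dI obtain t where t: "t \<in> K" "h t = a [^]\<^bsub>H\<^esub> int d" and d: "d > 0"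
      by (auto simp: I_def)
    have tc: "t \<in> carrier G" using t Kc by auto
    let ?E = "generate G (insert t (K \<inter> kernel G H h))"
    have "g \<in> ?E" if g: "g \<in> K" for g
    proof -
      obtain z :: int where z: "h g = a [^]\<^bsub>H\<^esub> z" using cyc g by blast
      have gc: "g \<in> carrier G" using g Kc by auto
      define q where "q = z div int d"
      let ?g = "g \<otimes> t [^] (- q)"
      have "h ?g = a [^]\<^bsub>H\<^esub> (z + int d * (- q))"
        using gc tc a z t by (simp add: hom_int_pow H.int_pow_pow flip: H.int_pow_mult)
      also have "z + int d * (- q) = z mod int d"
        unfolding q_def using minus_mult_div_eq_mod[of z "int d"] by simp
      finally have hg: "h ?g = a [^]\<^bsub>H\<^esub> (z mod int d)" .
      have gK: "?g \<in> K"
        using g t K by (simp add: G.subgroup_int_pow_closed subgroup.m_closed)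
      have "z mod int d = 0"
      proof (rule ccontr)
        assume "z mod int d \<noteq> 0"
        moreover have "z mod int d \<ge> 0" "z mod int d < int d" using d by auto
        ultimately have e: "nat (z mod int d) > 0" "int (nat (z mod int d)) = z mod int d"
          "nat (z mod int d) < d" by linarith+
        then have "nat (z mod int d) \<in> I" unfolding I_def using hg gK by (metis (mono_tags) mem_Collect_eq)
        then show False using dmin e(3) by (meson leD)
      qed
      then have "?g \<in> K \<inter> kernel G H h" using hg gK gc tc by (auto simp: kernel_def)
      then have "?g \<in> ?E" by (auto intro: generate.incl)
      moreover have "t [^] q \<in> ?E"
        using Kc t by (intro G.subgroup_int_pow_closed G.generate_is_subgroup)
          (auto intro: generate.incl)
      ultimately have "?g \<otimes> t [^] q \<in> ?E" by (rule generate.eng)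
      then show ?thesis using gc tc by (simp add: G.int_pow_neg G.m_assoc)
    qed
    then show ?thesis using sub t by blast
  qed
qed

context group
begin

text \<open>The argument is that for subgroups of finitely generated abelian groups. If P is
  generated by \<open>V\<close> and all of \<open>Y\<close> but one element, then P is normal and
  H/(H \<inter> P) is cyclic. One lift of a generator is added to those that induction provides for
  H \<inter> P.\<close>

lemma generators_modulo:
  assumes V: "subgroup V G" "derived G (carrier G) \<subseteq> V" and "finite Y" "Y \<subseteq> carrier G"
    and "subgroup H G" "V \<subseteq> H" "H \<subseteq> generate G (V \<union> Y)"
  shows "\<exists>T. finite T \<and> T \<subseteq> H \<and> card T \<le> card Y \<and> generate G (V \<union> T) = H"
  using assms(3-)
proof (induction Y arbitrary: H rule: finite_induct)
  case empty
  then have "generate G V = H"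
    using generate_subgroup_incl[of V V] V generate.incl[of _ V G] by auto
  then show ?case by (intro exI[of _ "{}"]) simp
next
  case (insert a Y)
  have Vc: "V \<subseteq> carrier G" using V by (simp add: subgroup.subset)
  define P where "P = generate G (V \<union> Y)"
  have P: "subgroup P G" unfolding P_def using insert Vc by (intro generate_is_subgroup) auto
  have VP: "V \<subseteq> P" "Y \<subseteq> P" unfolding P_def by (auto intro: generate.incl)
  have nP: "P \<lhd> G" using P V VP by (intro normal_if_derived_subset) auto
  let ?Q = "G Mod P" and ?f = "\<lambda>g. P #> g"
  interpret f: group_hom G ?Q ?f by (rule group_hom_r_coset[OF nP])
  have ac: "a \<in> carrier G" using insert by auto
  \<comment> \<open>This is the preimage of the cyclic subgroup generated by the image of
    \<open>a\<close>; it contains \<open>V\<close>, \<open>Y\<close> and \<open>a\<close>, hence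
    \<open>H\<close>.\<close>
  let ?L = "{g \<in> carrier G. \<exists>z::int. ?f g = (?f a) [^]\<^bsub>?Q\<^esub> z}"
  have ker: "?f p = \<one>\<^bsub>?Q\<^esub>" if "p \<in> P" for p
    using that kernel_r_coset[OF nP] by (auto simp: kernel_def)
  have fa: "?f a \<in> carrier ?Q" using ac by (rule f.hom_closed)
  have L: "subgroup ?L G"
  proof (rule subgroupI)
    have "\<one> \<in> ?L" using ker[OF subgroup.one_closed[OF P]] by (auto intro!: exI[of _ 0])
    then show "?L \<noteq> {}" by blast
  next
    fix g assume "g \<in> ?L"
    then show "inv g \<in> ?L" using fa by (auto simp add: f.hom_inv simp flip: f.H.int_pow_neg)
  next
    fix g g' assume "g \<in> ?L" "g' \<in> ?L"
    then obtain z z' :: int where *: "g \<in> carrier G" "g' \<in> carrier G"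
      "?f g = (?f a) [^]\<^bsub>?Q\<^esub> z" "?f g' = (?f a) [^]\<^bsub>?Q\<^esub> z'" by auto
    then have "?f (g \<otimes> g') = (?f a) [^]\<^bsub>?Q\<^esub> (z + z')"
      using fa f.hom_mult by (simp only: f.H.int_pow_mult)
    then show "g \<otimes> g' \<in> ?L" using * by blast
  qed auto
  have "V \<union> insert a Y \<subseteq> ?L"
  proof -
    have "a \<in> ?L" using ac fa by (auto intro!: exI[of _ 1] simp: f.H.int_pow_1)
    moreover have "P \<subseteq> ?L" using ker subgroup.subset[OF P] by (auto intro!: exI[of _ 0])
    ultimately show ?thesis using VP by blast
  qed
  then have HL: "H \<subseteq> ?L" using generate_subgroup_incl[OF _ L] insert.prems by blast
  have "\<exists>g\<in>H. generate G (insert g (H \<inter> kernel G ?Q ?f)) = H"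
    using HL insert.prems(2) by (intro f.subgroup_with_cyclic_image[OF _ fa]) blast+
  then obtain g where g: "g \<in> H" "generate G (insert g (H \<inter> P)) = H"
    unfolding kernel_r_coset[OF nP] by blast
  have "\<exists>T. finite T \<and> T \<subseteq> H \<inter> P \<and> card T \<le> card Y \<and> generate G (V \<union> T) = H \<inter> P"
    using insert.prems P VP by (intro insert.IH subgroups_Inter_pair) (auto simp: P_def)
  then obtain T where T: "finite T" "T \<subseteq> H \<inter> P" "card T \<le> card Y" "generate G (V \<union> T) = H \<inter> P"
    by blast
  have Hc: "H \<subseteq> carrier G" using insert.prems by (simp add: subgroup.subset)
  have "H \<inter> P \<subseteq> generate G (V \<union> insert g T)"
    using mono_generate[of "V \<union> T" "V \<union> insert g T"] T by auto
  then have "generate G (insert g (H \<inter> P)) \<subseteq> generate G (V \<union> insert g T)"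
    using Hc Vc g T by (intro generate_subgroup_incl generate_is_subgroup) (auto intro: generate.incl)
  moreover have "generate G (V \<union> insert g T) \<subseteq> H"
    using insert.prems g T by (intro generate_subgroup_incl) auto
  ultimately have "generate G (V \<union> insert g T) = H" using g by auto
  moreover have "card (insert g T) \<le> card (insert a Y)"
    using T insert.hyps by (auto simp: card_insert_if)
  ultimately show ?case using T g by (intro exI[of _ "insert g T"]) auto
qed

end

section \<open>Groups satisfying the relations\<close>

text \<open>Only the relations are postulated, not that they present \<open>G\<close>, so that
  quotients by a core or by the later subgroup \<open>V\<close> are instances too.\<close>

locale thompson_relations = group G for G (structure) +
  fixes x :: "nat \<Rightarrow> 'a" and m :: nat
  assumes x_closed [simp, intro]: "x i \<in> carrier G"
    and m_pos: "m > 0"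
    and rel: "j < i \<Longrightarrow> inv (x j) \<otimes> x i \<otimes> x j = x (i + m)"
begin

section \<open>Index shifts and torsion quotients\<close>

lemma shift: "j < i \<Longrightarrow> cj G (inv (x j)) (x i) = x (i + m)"
  by (simp add: cj_def rel)

lemma unshift: "j < i \<Longrightarrow> cj G (x j) (x (i + m)) = x i"
  by (metis shift cj_inv_cancel(2) x_closed)

lemma shift_pow: "j < i \<Longrightarrow> cj G (inv (x j) [^] (r::nat)) (x i) = x (i + r * m)"
proof (induction r)
  case (Suc r)
  then have "cj G (inv (x j) [^] Suc r) (x i) = cj G (inv (x j)) (x (i + r * m))"
    by (subst cj_pow_Suc(1)) simp_all
  also have "\<dots> = x (i + r * m + m)" using Suc.prems by (intro shift) simp
  finally show ?case by (simp add: add.commute add.left_commute)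
qed simp

lemma unshift_pow: "j < i \<Longrightarrow> cj G (x j [^] (r::nat)) (x (i + r * m)) = x i"
  by (metis shift_pow cj_inv_cancel(2) inv_closed nat_pow_closed nat_pow_inv x_closed)

lemma hom_image:
  assumes "group_hom G Q f"
  shows "thompson_relations Q (\<lambda>i. f (x i)) m"
proof -
  interpret f: group_hom G Q f by fact
  show ?thesis
  proof
    fix i j :: nat assume "j < i"
    then have "f (x (i + m)) = f (inv (x j) \<otimes> x i \<otimes> x j)" by (simp add: rel)
    then show "inv\<^bsub>Q\<^esub> f (x j) \<otimes>\<^bsub>Q\<^esub> f (x i) \<otimes>\<^bsub>Q\<^esub> f (x j) = f (x (i + m))" by simp
  qed (simp_all add: m_pos)
qed

text \<open>Conjugation by x_0^k is trivial, so indices have period km. This replaces x_i by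
  x_{i+km}, whose index exceeds i, and the relation for conjugation by x_i itself becomes
  available.\<close>

lemma periodic_if_torsion:
  assumes "k > 0" "\<And>i. x i [^] (k::nat) = \<one>" "i > 0"
  shows "x (i + m) = x i"
proof -
  have per: "x (i + k * m) = x i" if "i > 0" for i
    using shift_pow[OF that, of k] assms(2) by (simp add: nat_pow_inv)
  have "x (i + m) = x ((i + m) + k * m)" using per[of "i + m"] assms by simp
  also have "\<dots> = x ((i + k * m) + m)" by (simp add: ac_simps)
  also have "\<dots> = cj G (inv (x i)) (x (i + k * m))"
    using assms m_pos by (intro shift[symmetric]) simp
  also have "\<dots> = x i" using per[of i] assms by (simp add: cj_def)
  finally show ?thesis .
qed

text \<open>Under periodicity each defining relation turns into a commutation.\<close>

lemma comm_group_if_periodic: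
  assumes gen: "generate G (range x) = carrier G" and per: "\<And>i. i > 0 \<Longrightarrow> x (i + m) = x i"
  shows "comm_group G"
proof (rule comm_group_if_generators_commute[OF _ gen])
  have *: "x i \<otimes> x j = x j \<otimes> x i" if "j < i" for i j
  proof -
    have "inv (x j) \<otimes> (x i \<otimes> x j) = x i" using rel[OF that] per[of i] that by (simp add: m_assoc)
    then show ?thesis by (metis m_closed r_inv_mult_cancel x_closed)
  qed
  fix a b assume "a \<in> range x" "b \<in> range x"
  then show "a \<otimes> b = b \<otimes> a" using * by (metis imageE linorder_neqE_nat)
qed auto

section \<open>The elements c_i and the finitely generated subgroup D\<close>

definition c :: "nat \<Rightarrow> 'a" where
  "c i = x i \<otimes> inv (x (i + m))"

lemma c_closed [simp, intro]: "c i \<in> carrier G"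
  by (simp add: c_def)

lemma c_shift: "j < i \<Longrightarrow> cj G (inv (x j)) (c i) = c (i + m)"
  by (simp add: c_def cj_mult cj_inv shift)

text \<open>The factor x_{i+m}^{-1} raises the index j by m and x_i lowers it again; the former
  needs j to exceed i + m.\<close>

lemma cj_c_x:
  assumes "i + m < j"
  shows "cj G (c i) (x j) = x j"
proof -
  have "cj G (c i) (x j) = cj G (x i) (cj G (inv (x (i + m))) (x j))"
    by (simp add: c_def cj_cj)
  then show ?thesis using assms by (simp add: shift unshift)
qed

lemma cj_x_c: "i + m < j \<Longrightarrow> cj G (x j) (c i) = c i"
  by (simp add: cj_eq_self_iff cj_c_x)

text \<open>The range of indices ends at m + 1 because c_{m+1} occurs in x_1 c_1 x_1^{-1}. The
  exponents end at 2 because from there on \<open>c 1\<close> can replace \<open>x 1\<close> as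
  conjugator, by \<open>cj_c1\<close>.\<close>

definition S :: "'a set" where
  "S = insert (c 1) ((\<lambda>(a, i). cj G (x 1 [^] a) (c i)) ` ({..2::nat} \<times> {2..m+1}))"

definition D :: "'a set" where
  "D = generate G S"

definition U :: "'a set" where
  "U = sat (x 1) D"

text \<open>The inverse appears because it is conjugation by x_0^{-1}, which raises indices, that
  maps \<open>U\<close> into itself.\<close>

definition V :: "'a set" where
  "V = sat (inv (x 0)) U"

lemma finite_S: "finite S"
  by (simp add: S_def)

lemma card_S: "card S \<le> 3 * m + 1"
proof -
  have "card ((\<lambda>(a, i). cj G (x 1 [^] a) (c i)) ` ({..2::nat} \<times> {2..m+1}))
      \<le> card ({..2::nat} \<times> {2..m+1})"
    by (intro card_image_le) simp
  then show ?thesis unfolding S_def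
    by (intro order_trans[OF card_insert_le_m1[of "3 * m + 1"]]) auto
qed

lemma S_closed: "S \<subseteq> carrier G"
  by (auto simp: S_def)

lemma subgroup_D: "subgroup D G"
  unfolding D_def by (rule generate_is_subgroup[OF S_closed])

lemma S_subset_D: "S \<subseteq> D"
  unfolding D_def by (auto intro: generate.incl)

lemma cj_x1_c1: "cj G (x 1) (c 1) = c 1 \<otimes> inv (cj G (x 1) (c (m + 1)))"
proof -
  have "x (m + 1) \<otimes> x 1 = x 1 \<otimes> x (m + 1 + m)"
  proof -
    have "inv (x 1) \<otimes> (x (m + 1) \<otimes> x 1) = x (m + 1 + m)"
      using rel[of 1 "m + 1"] m_pos by (simp add: m_assoc)
    then show ?thesis by (metis m_closed r_inv_mult_cancel x_closed)
  qed
  \<comment> \<open>The left side is the middle of the product of \<open>c 1\<close> with the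
    inverse of \<open>cj G (x 1) (c (m + 1))\<close>, written out; replacing it by
    \<open>x 1\<close> gives the claim.\<close>
  then have *: "inv (x (m + 1)) \<otimes> (x 1 \<otimes> x (m + 1 + m)) = x 1"
    by (metis l_inv_mult_cancel x_closed)
  have "c 1 \<otimes> inv (cj G (x 1) (c (m + 1))) =
      x 1 \<otimes> ((inv (x (m + 1)) \<otimes> (x 1 \<otimes> x (m + 1 + m))) \<otimes> (inv (x (m + 1)) \<otimes> inv (x 1)))"
    by (simp add: c_def cj_def word_simps add.commute)
  also have "\<dots> = cj G (x 1) (c 1)"
    unfolding * by (simp add: c_def cj_def word_simps add.commute)
  finally show ?thesis by simp
qed

text \<open>In c_1 = x_1 x_{m+1}^{-1} the second factor commutes with x_1^2 c_i x_1^{-2}: pulling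
  x_{m+1} back through x_1^2 gives x_{3m+1}, and 3m + 1 > i + m, so this commutes with c_i.\<close>

lemma cj_c1:
  assumes "i \<le> m + 1"
  shows "cj G (c 1) (cj G (x 1 [^] (2::nat)) (c i)) = cj G (x 1 [^] (3::nat)) (c i)"
proof -
  let ?g = "cj G (x 1 [^] (2::nat)) (c i)"
  have "cj G (x 1 [^] (2::nat)) (cj G (x (m + 1 + 2 * m)) (c i)) = ?g"
    using assms m_pos by (simp add: cj_x_c)
  moreover have "cj G (x 1 [^] (2::nat)) (cj G (x (m + 1 + 2 * m)) (c i)) =
      cj G (cj G (x 1 [^] (2::nat)) (x (m + 1 + 2 * m))) ?g"
    by (simp add: cj_cj) (simp add: cj_def word_simps)
  moreover have "cj G (x 1 [^] (2::nat)) (x (m + 1 + 2 * m)) = x (m + 1)"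
    using m_pos by (intro unshift_pow) simp
  ultimately have fix_g: "cj G (x (m + 1)) ?g = ?g" by simp
  have "cj G (c 1) ?g = cj G (x 1) (cj G (inv (x (m + 1))) ?g)"
    by (simp add: c_def cj_cj m_assoc add.commute)
  also have "cj G (inv (x (m + 1))) ?g = ?g" using fix_g
    by (metis c_closed cj_closed cj_inv_cancel(1) nat_pow_closed x_closed)
  finally show ?thesis
    by (simp add: cj_pow_Suc(1) numeral_3_eq_3 numeral_2_eq_2 del: nat_pow_Suc Group.nat_pow_Suc)
qed

text \<open>On the generators: \<open>c 1\<close> is covered by \<open>cj_x1_c1\<close>, exponents
  below 2 rise within \<open>S\<close>, and at exponent 2 conjugation by \<open>x 1\<close> is
  conjugation by \<open>c 1\<close>, an element of \<open>D\<close>.\<close>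

lemma cj_x1_D:
  assumes "d \<in> D"
  shows "cj G (x 1) d \<in> D"
proof (rule cj_generate_subset[OF S_closed _ subgroup_D _ assms[unfolded D_def]])
  have mem: "cj G (x 1 [^] a) (c i) \<in> D" if "a \<le> 2" "2 \<le> i" "i \<le> m + 1" for a i :: nat
    using that S_subset_D by (force simp: S_def)
  have c1: "c 1 \<in> D" using S_subset_D by (simp add: S_def)
  fix s assume "s \<in> S"
  then consider "s = c 1" | a i where "a \<le> (2::nat)" "2 \<le> i" "i \<le> m + 1" "s = cj G (x 1 [^] a) (c i)"
    by (auto simp: S_def)
  then show "cj G (x 1) s \<in> D"
  proof cases
    case 1
    have "cj G (x 1) (c (m + 1)) \<in> D" using mem[of 1 "m + 1"] m_pos by simp
    then show ?thesis unfolding 1 cj_x1_c1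
      using c1 subgroup_D by (simp add: subgroup.m_closed subgroup.m_inv_closed)
  next
    case (2 a i)
    have "cj G (x 1 [^] Suc a) (c i) \<in> D"
    proof (cases "a = 2")
      case True
      then show ?thesis using cj_c1[of i] 2 mem[of 2 i] c1 subgroup_cj_closed[OF subgroup_D]
        by (metis eval_nat_numeral(3) order_refl)
    qed (use 2 in \<open>intro mem; simp\<close>)
    then show ?thesis using 2 by (simp add: cj_pow_Suc(1) del: nat_pow_Suc Group.nat_pow_Suc)
  qed
qed auto

section \<open>The union U and the elements normalising it\<close>

lemma subgroup_U: "subgroup U G"
  unfolding U_def by (intro subgroup_sat subgroup_D cj_x1_D) auto

lemma S_subset_U: "S \<subseteq> U"
  unfolding U_def using S_subset_D subset_sat[OF _ subgroup_D cj_x1_D] by blast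

lemma cj_x1_U: "g \<in> U \<Longrightarrow> cj G (x 1) g \<in> U" "g \<in> U \<Longrightarrow> cj G (inv (x 1)) g \<in> U"
  unfolding U_def using cj_sat[OF x_closed subgroup_D cj_x1_D] by blast+

text \<open>Indices up to m + 1 come from \<open>S\<close>, with exponent 0 if above 1. Beyond that,
  i - m exceeds 1, so x_1^{-1} shifts c_{i-m} to c_i.\<close>

lemma c_in_U: "i > 0 \<Longrightarrow> c i \<in> U"
proof (induction i rule: less_induct)
  case (less i)
  consider "i = 1" | "2 \<le> i" "i \<le> m + 1" | "i > m + 1" using less.prems by linarith
  then show ?case
  proof cases
    case 1
    then show ?thesis using S_subset_U by (simp add: S_def)
  next
    case 2
    then have "cj G (x 1 [^] (0::nat)) (c i) \<in> S" unfolding S_def by force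
    then show ?thesis using S_subset_U by auto
  next
    case 3
    then have "c (i - m) \<in> U" using less m_pos by simp
    then have "cj G (inv (x 1)) (c (i - m)) \<in> U" by (rule cj_x1_U)
    then show ?thesis using 3 by (simp add: c_shift)
  qed
qed

text \<open>The quotient telescopes into c_i c_{i+m} c_{i+2m} and so on.\<close>

lemma quotient_in_U:
  assumes "i > 0"
  shows "x i \<otimes> inv (x (i + q * m)) \<in> U"
proof (induction q)
  case 0
  then show ?case using subgroup_U by (simp add: subgroup.one_closed)
next
  case (Suc q)
  have "c (i + q * m) \<in> U" using assms by (intro c_in_U) simp
  then have "(x i \<otimes> inv (x (i + q * m))) \<otimes> c (i + q * m) \<in> U"
    using Suc subgroup_U by (simp add: subgroup.m_closed)
  then show ?case by (simp add: c_def word_simps ac_simps)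
qed

text \<open>This subgroup will contain \<open>U\<close>. Commuting with x_j for large j lets
  \<open>cj_x_U\<close> trade conjugation by x_i for conjugation by an element of
  \<open>U\<close>.\<close>

definition W :: "'a set" where
  "W = {g \<in> carrier G. \<exists>J. \<forall>j\<ge>J. cj G g (x j) = x j}"

lemma subgroup_W: "subgroup W G"
proof (rule subgroupI)
  show "W \<subseteq> carrier G" by (auto simp: W_def)
  have "\<one> \<in> W" by (simp add: W_def)
  then show "W \<noteq> {}" by blast
next
  fix g assume "g \<in> W"
  then obtain J where J: "g \<in> carrier G" "\<forall>j\<ge>J. cj G g (x j) = x j" by (auto simp: W_def)
  then have "\<forall>j\<ge>J. cj G (inv g) (x j) = x j" by (metis cj_inv_cancel(1) x_closed)
  then show "inv g \<in> W" using J by (auto simp: W_def)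
next
  fix g h assume "g \<in> W" "h \<in> W"
  then obtain J J' where J: "g \<in> carrier G" "\<forall>j\<ge>J. cj G g (x j) = x j"
    "h \<in> carrier G" "\<forall>j\<ge>J'. cj G h (x j) = x j" by (auto simp: W_def)
  then have "\<forall>j\<ge>max J J'. cj G (g \<otimes> h) (x j) = x j" by (simp flip: cj_cj)
  then show "g \<otimes> h \<in> W" using J unfolding W_def by blast
qed

text \<open>Conjugation by x_1 or its inverse only shifts the x_j of large index. The new thresholds
  leave room for a shift by m and keep the indices above 1.\<close>

lemma cj_x1_W:
  assumes "g \<in> W"
  shows "cj G (x 1) g \<in> W" "cj G (inv (x 1)) g \<in> W"
proof -
  from assms obtain J where J: "g \<in> carrier G" "\<And>j. j \<ge> J \<Longrightarrow> cj G g (x j) = x j"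
    by (auto simp: W_def)
  have "cj G (cj G (x 1) g) (x j) = x j" if "j \<ge> J + 2" for j
    using cj_cj_distrib[of "x 1" g "x (j + m)"] J that by (simp add: unshift)
  then show "cj G (x 1) g \<in> W" using J unfolding W_def by blast
  have "cj G (cj G (inv (x 1)) g) (x j) = x j" if j: "j \<ge> J + m + 2" for j
    using cj_cj_distrib[of "inv (x 1)" g "x (j - m)"] J j by (simp add: shift)
  then show "cj G (inv (x 1)) g \<in> W" using J unfolding W_def by blast
qed

lemma c_in_W: "c i \<in> W"
  unfolding W_def by (auto intro!: exI[of _ "Suc (i + m)"] cj_c_x)

lemma cj_x1_pow_W: "g \<in> W \<Longrightarrow> cj G (x 1 [^] (r::nat)) g \<in> W"
proof (induction r)
  case (Suc r)
  then show ?case using cj_x1_W(1) subgroup.mem_carrier[OF subgroup_W]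
    by (simp add: cj_pow_Suc(1) del: nat_pow_Suc Group.nat_pow_Suc)
qed (use subgroup.mem_carrier[OF subgroup_W] in simp)

lemma U_subset_W: "U \<subseteq> W"
proof -
  have "S \<subseteq> W" using c_in_W cj_x1_pow_W by (auto simp: S_def simp flip: One_nat_def)
  then have "D \<subseteq> W" unfolding D_def by (rule generate_subgroup_incl[OF _ subgroup_W])
  \<comment> \<open>Elements of \<open>U\<close> are known only through a conjugate in
    \<open>D\<close>, so powers of x_1 are removed one at a time.\<close>
  have undo: "g \<in> W" if "g \<in> carrier G" "cj G (x 1 [^] (r::nat)) g \<in> W" for g r
    using that
  proof (induction r)
    case (Suc r)
    then have "cj G (inv (x 1)) (cj G (x 1) (cj G (x 1 [^] r) g)) \<in> W"
      by (intro cj_x1_W(2)) (simp add: cj_pow_Suc(1) del: nat_pow_Suc Group.nat_pow_Suc)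
    then show ?case using Suc by simp
  qed simp
  then show ?thesis using \<open>D \<subseteq> W\<close> by (auto simp: U_def sat_def)
qed

text \<open>Choose j congruent to i modulo m and so large that x_j commutes with \<open>g\<close>.
  Then x_i acts on \<open>g\<close> as x_i x_j^{-1} does, which lies in \<open>U\<close>; likewise
  x_i^{-1} acts as x_i^{-1} x_j.\<close>

lemma cj_x_U:
  assumes "i > 0" "g \<in> U"
  shows "cj G (x i) g \<in> U" "cj G (inv (x i)) g \<in> U"
proof -
  have gc: "g \<in> carrier G" using assms subgroup.mem_carrier[OF subgroup_U] by blast
  obtain J where J: "\<And>j. j \<ge> J \<Longrightarrow> cj G g (x j) = x j"
    using assms U_subset_W by (auto simp: W_def)
  define j where "j = i + Suc J * m"
  have "J \<le> Suc J * m" using m_pos by (cases m) auto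
  then have j: "j \<ge> J" "i < j" using m_pos by (simp_all add: j_def)
  have fix_g: "cj G (x j) g = g" using J[OF j(1)] gc by (simp add: cj_eq_self_iff)
  then have fix_g': "cj G (inv (x j)) g = g" using gc by (metis cj_inv_cancel(1) x_closed)
  have "x i \<otimes> inv (x j) \<in> U" unfolding j_def by (rule quotient_in_U[OF assms(1)])
  then have "cj G (x i \<otimes> inv (x j)) g \<in> U" using assms subgroup_cj_closed[OF subgroup_U] by blast
  also have "cj G (x i \<otimes> inv (x j)) g = cj G (x i) g"
    using fix_g' gc by (simp flip: cj_cj)
  finally show "cj G (x i) g \<in> U" .
  \<comment> \<open>The index j + m is taken because the inverse x_{j+m} x_i^{-1} equals x_i^{-1}
    x_j by the relation for i < j.\<close>
  have "x i \<otimes> inv (x (j + m)) \<in> U"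
    using quotient_in_U[OF assms(1), of "Suc (Suc J)"] by (simp add: j_def ac_simps)
  then have "inv (x i \<otimes> inv (x (j + m))) \<in> U" using subgroup_U by (simp add: subgroup.m_inv_closed)
  also have "inv (x i \<otimes> inv (x (j + m))) = inv (x i) \<otimes> x j"
    using rel[OF j(2)] by (simp add: word_simps flip: rel[OF j(2)])
  finally have "cj G (inv (x i) \<otimes> x j) g \<in> U"
    using assms subgroup_cj_closed[OF subgroup_U] by blast
  also have "cj G (inv (x i) \<otimes> x j) g = cj G (inv (x i)) g"
    using fix_g gc by (simp flip: cj_cj)
  finally show "cj G (inv (x i)) g \<in> U" .
qed

lemma cj_x_pow_U:
  assumes "i > 0" "g \<in> U"
  shows "cj G (x i [^] (r::nat)) g \<in> U" "cj G (inv (x i [^] r)) g \<in> U"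
proof -
  have gc: "g \<in> carrier G" using assms subgroup.mem_carrier[OF subgroup_U] by blast
  show "cj G (x i [^] r) g \<in> U"
    by (induction r) (use assms gc cj_x_U in \<open>simp_all add: cj_pow_Suc(1) del: nat_pow_Suc Group.nat_pow_Suc\<close>)
  have "cj G (inv (x i) [^] r) g \<in> U"
    by (induction r) (use assms gc cj_x_U in \<open>simp_all add: cj_pow_Suc(1) del: nat_pow_Suc Group.nat_pow_Suc\<close>)
  then show "cj G (inv (x i [^] r)) g \<in> U" by (simp add: nat_pow_inv)
qed

text \<open>Conjugation by x_0^{-1} turns c_i into c_{i+m} and the conjugator x_1 into x_{1+m},
  which normalises \<open>U\<close>. This treats the generators of \<open>D\<close> first and then
  the passage from \<open>D\<close> to \<open>U\<close>.\<close>

lemma cj_x0_U: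
  assumes "g \<in> U"
  shows "cj G (inv (x 0)) g \<in> U"
proof -
  have x1: "cj G (inv (x 0)) (x 1 [^] r) = x (1 + m) [^] r" for r :: nat
    by (simp add: cj_pow shift)
  have D: "cj G (inv (x 0)) d \<in> U" if "d \<in> D" for d
  proof (rule cj_generate_subset[OF S_closed _ subgroup_U _ that[unfolded D_def]])
    fix s assume "s \<in> S"
    then consider "s = c 1" | a i where "2 \<le> i" "s = cj G (x 1 [^] (a::nat)) (c i)"
      by (auto simp: S_def)
    then show "cj G (inv (x 0)) s \<in> U"
    proof cases
      case 1
      then show ?thesis by (simp add: c_shift c_in_U)
    next
      case (2 a i)
      then show ?thesis
        using cj_x_pow_U(1)[of "1 + m" "c (i + m)" a] cj_cj_distrib[of "inv (x 0)" "x 1 [^] a" "c i"]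
        by (simp only: x1) (simp add: c_shift c_in_U)
    qed
  qed auto
  from assms obtain r where r: "g \<in> carrier G" "cj G (x 1 [^] (r::nat)) g \<in> D"
    by (auto simp: U_def sat_def)
  have "cj G (x (1 + m) [^] r) (cj G (inv (x 0)) g) \<in> U"
    using D[OF r(2)] r cj_cj_distrib[of "inv (x 0)" "x 1 [^] r" g] by (simp only: x1) simp
  from cj_x_pow_U(2)[OF _ this, of "1 + m" r] show ?thesis using r by simp
qed

section \<open>The normal subgroup V\<close>

lemma subgroup_V: "subgroup V G"
  unfolding V_def by (intro subgroup_sat subgroup_U cj_x0_U) auto

lemma U_subset_V: "U \<subseteq> V"
  unfolding V_def using subset_sat[OF _ subgroup_U cj_x0_U] by blast

text \<open>For x_0 this is built into the union. For i > 0, conjugating by x_0^{-r} turns x_i into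
  x_{i+rm}, which still normalises \<open>U\<close>.\<close>

lemma cj_x_V:
  assumes "g \<in> V"
  shows "cj G (x i) g \<in> V \<and> cj G (inv (x i)) g \<in> V"
proof (cases "i = 0")
  case True
  then show ?thesis
    using assms cj_sat[OF inv_closed[OF x_closed] subgroup_U cj_x0_U] by (simp add: V_def)
next
  case False
  from assms obtain r where r: "g \<in> carrier G" "cj G (inv (x 0) [^] (r::nat)) g \<in> U"
    by (auto simp: V_def sat_def)
  have xi: "cj G (inv (x 0) [^] r) (x i) = x (i + r * m)" using False by (intro shift_pow) simp
  have "cj G (inv (x 0) [^] r) (cj G (x i) g) \<in> U"
    using cj_x_U(1)[OF _ r(2), of "i + r * m"] r False
      cj_cj_distrib[of "inv (x 0) [^] r" "x i" g] by (simp add: xi)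
  moreover have "cj G (inv (x 0) [^] r) (cj G (inv (x i)) g) \<in> U"
    using cj_x_U(2)[OF _ r(2), of "i + r * m"] r False
      cj_cj_distrib[of "inv (x 0) [^] r" "inv (x i)" g] by (simp add: xi cj_inv)
  ultimately show ?thesis using r by (auto simp: V_def sat_def)
qed

text \<open>\<open>sat_subset\<close> is applied twice, to x_1 and \<open>D\<close>, then to
  x_0^{-1} and \<open>U\<close>. As \<open>S\<close> does not depend on \<open>k\<close> or
  \<open>K\<close>, this is the source of the uniform bound.\<close>

lemma V_subset:
  assumes K: "subgroup K G" "S \<subseteq> K" and k: "k > 0" "x 0 [^] (k::nat) \<in> K" "x 1 [^] k \<in> K"
  shows "V \<subseteq> K"
proof -
  have "D \<subseteq> K" unfolding D_def using K by (intro generate_subgroup_incl)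
  then have "U \<subseteq> K"
    unfolding U_def using K k sat_subset[OF _ subgroup_D cj_x1_D] by (metis x_closed)
  moreover have "inv (x 0) [^] k \<in> K" using K k by (simp add: nat_pow_inv subgroup.m_inv_closed)
  ultimately show ?thesis
    unfolding V_def using K k sat_subset[OF _ subgroup_U cj_x0_U] by (metis inv_closed x_closed)
qed

section \<open>Finite-index subgroups when the x_i generate the group\<close>

context
  assumes gen: "generate G (range x) = carrier G"
begin

lemma V_normal: "V \<lhd> G"
  using gen cj_x_V by (intro normal_if_generators_normalise[OF subgroup_V, of "range x"]) auto

text \<open>The quotient by \<open>V\<close> satisfies the same relations and is periodic, since
  \<open>V\<close> contains every c_i with i > 0; hence it is abelian.\<close>

lemma derived_subset_V: "derived G (carrier G) \<subseteq> V"
proof (rule derived_minimal[OF V_normal])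
  let ?f = "\<lambda>g. V #> g"
  interpret f: group_hom G "G Mod V" ?f by (rule group_hom_r_coset[OF V_normal])
  interpret Q: thompson_relations "G Mod V" "\<lambda>i. V #> x i" m
    by (rule hom_image) (rule f.group_hom_axioms)
  show "comm_group (G Mod V)"
  proof (rule Q.comm_group_if_periodic)
    have "generate (G Mod V) (?f ` range x) = ?f ` generate G (range x)"
      by (rule f.generate_img) auto
    also have "\<dots> = carrier (G Mod V)" unfolding gen by (auto simp: FactGroup_def RCOSETS_def)
    finally show "generate (G Mod V) (range (\<lambda>i. V #> x i)) = carrier (G Mod V)"
      by (simp add: image_image)
  next
    fix i :: nat assume "i > 0"
    then have "c i \<in> V" using c_in_U U_subset_V by blast
    then have "x i \<in> V #> x (i + m)"
      by (auto simp: r_coset_def c_def m_assoc intro!: bexI[of _ "c i"])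
    then show "V #> x (i + m) = V #> x i"
      using subgroup_V by (intro repr_independence) auto
  qed
qed

text \<open>For i > m, x_i = c_{i-m}^{-1} x_{i-m} with i - m > 0. Membership of c_i in
  \<open>V\<close> is available for i > 0 only, so x_0 is kept beside x_1, ..., x_m.\<close>

lemma generate_V_Un: "generate G (V \<union> x ` {0..m}) = carrier G"
proof -
  let ?E = "generate G (V \<union> x ` {0..m})"
  have Vc: "V \<union> x ` {0..m} \<subseteq> carrier G" using subgroup.subset[OF subgroup_V] by auto
  have E: "subgroup ?E G" by (rule generate_is_subgroup[OF Vc])
  have "x i \<in> ?E" for i
  proof (induction i rule: less_induct)
    case (less i)
    show ?case
    proof (cases "i \<le> m")
      case False
      then have "c (i - m) \<in> V" using c_in_U[of "i - m"] U_subset_V by auto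
      then have "c (i - m) \<in> ?E" by (auto intro: generate.incl)
      moreover have "x (i - m) \<in> ?E" using False m_pos by (intro less) simp
      ultimately have "inv (c (i - m)) \<otimes> x (i - m) \<in> ?E"
        using E by (simp add: subgroup.m_closed subgroup.m_inv_closed)
      then show ?thesis using False by (simp add: c_def word_simps)
    qed (auto intro: generate.incl)
  qed
  then have "generate G (range x) \<subseteq> ?E" by (intro generate_subgroup_incl E) auto
  then show ?thesis using gen subgroup.subset[OF E] by auto
qed

text \<open>Modulo the core all x_i have k-th power trivial, so the quotient is periodic and the
  core contains c_i for i > 0; normality adds their conjugates.\<close>

lemma S_subset_core:
  assumes H: "subgroup H G" and fin: "finite (rcosets H)"
  shows "S \<subseteq> core H"
proof -
  define k :: nat where "k = fact (card (rcosets H))"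
  define N where "N = core H"
  have nN: "N \<lhd> G" unfolding N_def by (rule core_normal[OF H])
  then have N: "subgroup N G" by (rule normal_imp_subgroup)
  let ?f = "\<lambda>g. N #> g"
  interpret f: group_hom G "G Mod N" ?f by (rule group_hom_r_coset[OF nN])
  interpret Q: thompson_relations "G Mod N" "\<lambda>i. N #> x i" m
    by (rule hom_image) (rule f.group_hom_axioms)
  have pow: "(N #> x i) [^]\<^bsub>G Mod N\<^esub> k = \<one>\<^bsub>G Mod N\<^esub>" for i
  proof -
    have "x i [^] k \<in> kernel G (G Mod N) ?f"
      unfolding kernel_r_coset[OF nN] unfolding N_def k_def
      by (rule pow_fact_index_in_core[OF H fin x_closed])
    then have "?f (x i [^] k) = \<one>\<^bsub>G Mod N\<^esub>" by (simp only: kernel_def mem_Collect_eq)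
    then show ?thesis by (subst f.hom_nat_pow[symmetric]) auto
  qed
  have c: "c i \<in> N" if "i > 0" for i
  proof -
    have "N #> x (i + m) = N #> x i"
      using Q.periodic_if_torsion[OF _ pow that] by (simp add: k_def)
    then have "x i \<in> N #> x (i + m)" using N rcos_self[of "x i" N] by simp
    then obtain p where p: "p \<in> N" "x i = p \<otimes> x (i + m)" by (auto simp: r_coset_def)
    then have "c i = p" unfolding c_def using subgroup.mem_carrier[OF N p(1)] by (simp add: m_assoc)
    then show ?thesis using p by simp
  qed
  have "cj G a g \<in> N" if "a \<in> carrier G" "g \<in> N" for a g
    unfolding cj_def using normal.inv_op_closed2[OF nN that] .
  then show ?thesis unfolding S_def N_def[symmetric] using c by auto
qed

text \<open>\<open>S\<close> and the k-th powers of x_0 and x_1 generate a subgroup of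
  \<open>H\<close> containing \<open>V\<close>; what remains is to generate \<open>H\<close> modulo
  \<open>V\<close>.\<close>

theorem finite_index_generators:
  assumes H: "subgroup H G" and fin: "finite (rcosets H)"
  shows "\<exists>T. finite T \<and> T \<subseteq> H \<and> generate G T = H \<and> card T \<le> 4 * m + 4"
proof -
  define k :: nat where "k = fact (card (rcosets H))"
  have k: "k > 0" by (simp add: k_def)
  have xk: "x i [^] k \<in> H" for i
    using pow_fact_index_in_core[OF H fin x_closed] core_subset unfolding k_def by blast
  define R where "R = S \<union> {x 0 [^] k, x 1 [^] k}"
  have R: "R \<subseteq> H"
    unfolding R_def using xk S_subset_core[OF H fin] core_subset by blast
  have Hc: "H \<subseteq> carrier G" using H by (rule subgroup.subset)
  have "V \<subseteq> generate G R"
    using R Hc k unfolding R_def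
    by (intro V_subset[of _ k] generate_is_subgroup) (auto intro: generate.incl)
  moreover have "generate G R \<subseteq> H" using R H by (rule generate_subgroup_incl)
  ultimately have VH: "V \<subseteq> H" by blast
  obtain T where T: "finite T" "T \<subseteq> H" "card T \<le> card (x ` {0..m})" "generate G (V \<union> T) = H"
    using generators_modulo[OF subgroup_V derived_subset_V, of "x ` {0..m}" H] H VH Hc
    unfolding generate_V_Un by auto
  have "generate G R \<subseteq> generate G (R \<union> T)" by (rule mono_generate) simp
  then have "V \<union> T \<subseteq> generate G (R \<union> T)"
    using \<open>V \<subseteq> generate G R\<close> by (auto intro: generate.incl)
  then have "H \<subseteq> generate G (R \<union> T)"
    unfolding T(4)[symmetric] using R T Hc
    by (intro generate_subgroup_incl generate_is_subgroup) auto
  moreover have "generate G (R \<union> T) \<subseteq> H" using R T H by (intro generate_subgroup_incl) auto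
  \<comment> \<open>The count is 3m + 1 for \<open>S\<close>, 2 for the two powers and m + 1 for
    \<open>T\<close>.\<close>
  moreover have "card (R \<union> T) \<le> 4 * m + 4"
  proof -
    have "card (x ` {0..m}) \<le> m + 1" using card_image_le[of "{0..m}" x] by simp
    moreover have "card {x 0 [^] k, x 1 [^] k} \<le> 2" by (simp add: card_insert_if)
    ultimately show ?thesis
      using T(3) card_S card_Un_le[of R T] card_Un_le[of S "{x 0 [^] k, x 1 [^] k}"]
      unfolding R_def by linarith
  qed
  ultimately show ?thesis
    using R T finite_S by (intro exI[of _ "R \<union> T"]) (auto simp: R_def)
qed

end

end

section \<open>The presented group\<close>

definition F_class :: "nat \<Rightarrow> letter list \<Rightarrow> letter list set" where
  "F_class n w = {v. F_eq n w v}"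

lemma F_class_eq_iff: "F_class n u = F_class n v \<longleftrightarrow> F_eq n u v"
  unfolding F_class_def by (blast intro: F_refl F_sym F_trans)

lemma carrier_thompson_F: "carrier (thompson_F n) = range (F_class n)"
  by (auto simp: thompson_F_def F_class_def)

lemma one_thompson_F: "\<one>\<^bsub>thompson_F n\<^esub> = F_class n []"
  by (simp add: thompson_F_def F_class_def)

lemma mult_thompson_F: "F_class n u \<otimes>\<^bsub>thompson_F n\<^esub> F_class n v = F_class n (u @ v)"
proof -
  have "F_eq n (u @ v) w" if "F_eq n u a" "F_eq n v b" "F_eq n (a @ b) w" for a b w
    using F_trans[OF F_cong[OF that(1,2)] that(3)] .
  then show ?thesis by (auto simp: thompson_F_def F_class_def intro: F_refl)
qed

definition inv_word :: "letter list \<Rightarrow> letter list" where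
  "inv_word w = rev (map (\<lambda>(i, b). (i, \<not> b)) w)"

lemma F_eq_inv_word: "F_eq n (inv_word w @ w) []"
proof (induction w)
  case Nil
  then show ?case by (simp add: inv_word_def F_refl)
next
  case (Cons l w)
  obtain i b where l: "l = (i, b)" by force
  have "F_eq n [(i, \<not> b), (i, b)] []" using F_free[of n i "\<not> b"] by simp
  then have "F_eq n (inv_word w @ ([(i, \<not> b), (i, b)] @ w)) (inv_word w @ ([] @ w))"
    by (intro F_cong F_refl)
  then have "F_eq n (inv_word (l # w) @ l # w) (inv_word w @ w)" by (simp add: inv_word_def l)
  then show ?case using Cons by (rule F_trans)
qed

lemma group_thompson_F: "group (thompson_F n)"
proof (rule groupI)
  fix A assume "A \<in> carrier (thompson_F n)"
  then obtain w where A: "A = F_class n w" by (auto simp: carrier_thompson_F)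
  show "\<exists>B\<in>carrier (thompson_F n). B \<otimes>\<^bsub>thompson_F n\<^esub> A = \<one>\<^bsub>thompson_F n\<^esub>"
    by (rule bexI[of _ "F_class n (inv_word w)"])
      (auto simp: A mult_thompson_F one_thompson_F F_class_eq_iff F_eq_inv_word carrier_thompson_F)
qed (auto simp: carrier_thompson_F mult_thompson_F one_thompson_F)

lemma inv_F_generator:
  "inv\<^bsub>thompson_F n\<^esub> F_class n [(i, False)] = F_class n [(i, True)]"
  using F_free[of n i True]
  by (intro group.inv_equality[OF group_thompson_F])
    (auto simp: mult_thompson_F one_thompson_F F_class_eq_iff carrier_thompson_F)

lemma thompson_relations_thompson_F:
  assumes "n \<ge> 2"
  shows "thompson_relations (thompson_F n) (\<lambda>i. F_class n [(i, False)]) (n - 1)"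
proof (intro thompson_relations.intro thompson_relations_axioms.intro group_thompson_F)
  fix i j :: nat assume "j < i"
  then show "inv\<^bsub>thompson_F n\<^esub> F_class n [(j, False)] \<otimes>\<^bsub>thompson_F n\<^esub> F_class n [(i, False)]
      \<otimes>\<^bsub>thompson_F n\<^esub> F_class n [(j, False)] = F_class n [(i + (n - 1), False)]"
    using F_rel[of j i n] assms by (simp add: inv_F_generator mult_thompson_F F_class_eq_iff)
qed (use assms in \<open>auto simp: carrier_thompson_F\<close>)

lemma generate_thompson_F:
  "generate (thompson_F n) (range (\<lambda>i. F_class n [(i, False)])) = carrier (thompson_F n)"
    (is "generate ?G ?Y = _")
proof
  show "generate ?G ?Y \<subseteq> carrier ?G"
    by (rule group.generate_incl[OF group_thompson_F]) (auto simp: carrier_thompson_F)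
  have letter: "F_class n [(i, b)] \<in> generate ?G ?Y" for i b
  proof (cases b)
    case True
    then show ?thesis
      using generate.inv[of "F_class n [(i, False)]" ?Y ?G] by (simp add: inv_F_generator)
  qed (auto intro: generate.incl)
  have "F_class n w \<in> generate ?G ?Y" for w
  proof (induction w)
    case Nil
    then show ?case using generate.one[of ?G] by (simp add: one_thompson_F)
  next
    case (Cons l w)
    then show ?case
      using generate.eng[OF letter[of "fst l" "snd l"] Cons] by (simp add: mult_thompson_F)
  qed
  then show "carrier ?G \<subseteq> generate ?G ?Y" by (auto simp: carrier_thompson_F)
qed

text \<open>Finite generation is asserted alongside the bound so that the \<open>LEAST\<close> in
  \<open>min_gens\<close> ranges over a nonempty set and is the true minimum.\<close>

theorem theoremA1:
  fixes n :: nat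
  assumes "n \<ge> 2"
  shows "\<exists>C::nat. \<forall>H. subgroup H (thompson_F n) \<and> finite (rcosets\<^bsub>thompson_F n\<^esub> H) \<longrightarrow>
           (\<exists>S. finite S \<and> S \<subseteq> H \<and> generate (thompson_F n) S = H) \<and>
           min_gens (thompson_F n) H \<le> C"
proof (intro exI[of _ "4 * (n - 1) + 4"] allI impI)
  fix H assume "subgroup H (thompson_F n) \<and> finite (rcosets\<^bsub>thompson_F n\<^esub> H)"
  then obtain T where T: "finite T" "T \<subseteq> H" "generate (thompson_F n) T = H"
    "card T \<le> 4 * (n - 1) + 4"
    using thompson_relations.finite_index_generators[OF thompson_relations_thompson_F[OF assms]
        generate_thompson_F] by blast
  have "min_gens (thompson_F n) H \<le> card T"
    unfolding min_gens_def by (rule Least_le) (use T in blast)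
  then show "(\<exists>S. finite S \<and> S \<subseteq> H \<and> generate (thompson_F n) S = H) \<and>
      min_gens (thompson_F n) H \<le> 4 * (n - 1) + 4"
    using T by auto
qed

end
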